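(* For each integer $n\ge1$ there is a positive $\exists\forall$-sentence in the language of lattices which is true in the free lattice $\mathbf F_n$ and false in the free lattice $\mathbf F_{n+1}$. In particular, finitely generated free lattices are pairwise distinguished by positive first-order sentences.
   Context: $\mathbf F_n$ denotes the free lattice on $n$ generators. A positive first-order sentence is one built from atomic formulas (equations or inequalities $s\le t$ between lattice terms) using only conjunction, disjunction, and the quantifiers $\exists,\forall$ (no negations). An $\exists\forall$-sentence is one in prenex form consisting of a block of existential quantifiers followed by a block of universal quantifiers followed by a quantifier-free formula (either block may be empty). *)

theory Defs
  imports "HOL-Algebra.Lattice"
begin

section \<open>Lattice terms and free lattices\<close>

datatype (vars: 'a) lterm =
    Var 'a
  | Meet "'a lterm" "'a lterm"
  | Join "'a lterm" "'a lterm"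

definition terms_over :: "'a set \<Rightarrow> 'a lterm set" where
  "terms_over X = {t. vars t \<subseteq> X}"

text \<open>
  The least congruence on the algebra of lattice terms over \<open>X\<close> that contains all instances of
  the lattice identities (the idempotent laws follow from absorption).
\<close>

inductive_set lat_cong :: "'a set \<Rightarrow> ('a lterm \<times> 'a lterm) set" for X :: "'a set" where
  refl: "s \<in> terms_over X \<Longrightarrow> (s, s) \<in> lat_cong X"
| sym: "(s, t) \<in> lat_cong X \<Longrightarrow> (t, s) \<in> lat_cong X"
| trans: "(s, t) \<in> lat_cong X \<Longrightarrow> (t, u) \<in> lat_cong X \<Longrightarrow> (s, u) \<in> lat_cong X"
| Meet_cong: "(s, s') \<in> lat_cong X \<Longrightarrow> (t, t') \<in> lat_cong X \<Longrightarrow> (Meet s t, Meet s' t') \<in> lat_cong X"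
| Join_cong: "(s, s') \<in> lat_cong X \<Longrightarrow> (t, t') \<in> lat_cong X \<Longrightarrow> (Join s t, Join s' t') \<in> lat_cong X"
| Meet_comm: "s \<in> terms_over X \<Longrightarrow> t \<in> terms_over X \<Longrightarrow> (Meet s t, Meet t s) \<in> lat_cong X"
| Join_comm: "s \<in> terms_over X \<Longrightarrow> t \<in> terms_over X \<Longrightarrow> (Join s t, Join t s) \<in> lat_cong X"
| Meet_assoc: "s \<in> terms_over X \<Longrightarrow> t \<in> terms_over X \<Longrightarrow> u \<in> terms_over X \<Longrightarrow>
    (Meet (Meet s t) u, Meet s (Meet t u)) \<in> lat_cong X"
| Join_assoc: "s \<in> terms_over X \<Longrightarrow> t \<in> terms_over X \<Longrightarrow> u \<in> terms_over X \<Longrightarrow>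
    (Join (Join s t) u, Join s (Join t u)) \<in> lat_cong X"
| Meet_absorb: "s \<in> terms_over X \<Longrightarrow> t \<in> terms_over X \<Longrightarrow> (Meet s (Join s t), s) \<in> lat_cong X"
| Join_absorb: "s \<in> terms_over X \<Longrightarrow> t \<in> terms_over X \<Longrightarrow> (Join s (Meet s t), s) \<in> lat_cong X"

definition free_lattice :: "'a set \<Rightarrow> 'a lterm set gorder" where
  "free_lattice X =
    \<lparr>carrier = terms_over X // lat_cong X,
     eq = (=),
     le = (\<lambda>A B. \<exists>s\<in>A. \<exists>t\<in>B. (Meet s t, s) \<in> lat_cong X)\<rparr>"

abbreviation FL :: "nat \<Rightarrow> nat lterm set gorder" where
  "FL n \<equiv> free_lattice {..<n}"


section \<open>First-order sentences in the language of lattices\<close>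

datatype fm =
    Eq "nat lterm" "nat lterm"
  | Le "nat lterm" "nat lterm"
  | Neg fm
  | Conj fm fm
  | Disj fm fm
  | Exi nat fm
  | All nat fm

primrec eval :: "('b, 'c) gorder_scheme \<Rightarrow> ('a \<Rightarrow> 'b) \<Rightarrow> 'a lterm \<Rightarrow> 'b" where
  "eval L v (Var x) = v x"
| "eval L v (Meet s t) = eval L v s \<sqinter>\<^bsub>L\<^esub> eval L v t"
| "eval L v (Join s t) = eval L v s \<squnion>\<^bsub>L\<^esub> eval L v t"

primrec sat :: "('b, 'c) gorder_scheme \<Rightarrow> (nat \<Rightarrow> 'b) \<Rightarrow> fm \<Rightarrow> bool" where
  "sat L v (Eq s t) \<longleftrightarrow> eval L v s = eval L v t"
| "sat L v (Le s t) \<longleftrightarrow> eval L v s \<sqsubseteq>\<^bsub>L\<^esub> eval L v t"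
| "sat L v (Neg \<phi>) \<longleftrightarrow> \<not> sat L v \<phi>"
| "sat L v (Conj \<phi> \<psi>) \<longleftrightarrow> sat L v \<phi> \<and> sat L v \<psi>"
| "sat L v (Disj \<phi> \<psi>) \<longleftrightarrow> sat L v \<phi> \<or> sat L v \<psi>"
| "sat L v (Exi x \<phi>) \<longleftrightarrow> (\<exists>a\<in>carrier L. sat L (v(x := a)) \<phi>)"
| "sat L v (All x \<phi>) \<longleftrightarrow> (\<forall>a\<in>carrier L. sat L (v(x := a)) \<phi>)"

primrec fv :: "fm \<Rightarrow> nat set" where
  "fv (Eq s t) = vars s \<union> vars t"
| "fv (Le s t) = vars s \<union> vars t"
| "fv (Neg \<phi>) = fv \<phi>"
| "fv (Conj \<phi> \<psi>) = fv \<phi> \<union> fv \<psi>"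
| "fv (Disj \<phi> \<psi>) = fv \<phi> \<union> fv \<psi>"
| "fv (Exi x \<phi>) = fv \<phi> - {x}"
| "fv (All x \<phi>) = fv \<phi> - {x}"

definition sentence :: "fm \<Rightarrow> bool" where
  "sentence \<phi> \<longleftrightarrow> fv \<phi> = {}"

text \<open>
  Meant for sentences, whose truth value does not depend on the assignment \<open>v\<close>
  (see \<open>true_in_iff_sat\<close> below).
\<close>

definition true_in :: "('b, 'c) gorder_scheme \<Rightarrow> fm \<Rightarrow> bool" where
  "true_in L \<phi> \<longleftrightarrow> (\<forall>v. range v \<subseteq> carrier L \<longrightarrow> sat L v \<phi>)"

primrec positive :: "fm \<Rightarrow> bool" where
  "positive (Eq s t) \<longleftrightarrow> True"
| "positive (Le s t) \<longleftrightarrow> True"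
| "positive (Neg \<phi>) \<longleftrightarrow> False"
| "positive (Conj \<phi> \<psi>) \<longleftrightarrow> positive \<phi> \<and> positive \<psi>"
| "positive (Disj \<phi> \<psi>) \<longleftrightarrow> positive \<phi> \<and> positive \<psi>"
| "positive (Exi x \<phi>) \<longleftrightarrow> positive \<phi>"
| "positive (All x \<phi>) \<longleftrightarrow> positive \<phi>"

primrec quantifier_free :: "fm \<Rightarrow> bool" where
  "quantifier_free (Eq s t) \<longleftrightarrow> True"
| "quantifier_free (Le s t) \<longleftrightarrow> True"
| "quantifier_free (Neg \<phi>) \<longleftrightarrow> quantifier_free \<phi>"
| "quantifier_free (Conj \<phi> \<psi>) \<longleftrightarrow> quantifier_free \<phi> \<and> quantifier_free \<psi>"
| "quantifier_free (Disj \<phi> \<psi>) \<longleftrightarrow> quantifier_free \<phi> \<and> quantifier_free \<psi>"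
| "quantifier_free (Exi x \<phi>) \<longleftrightarrow> False"
| "quantifier_free (All x \<phi>) \<longleftrightarrow> False"

definition exists_forall :: "fm \<Rightarrow> bool" where
  "exists_forall \<phi> \<longleftrightarrow>
    (\<exists>xs ys \<psi>. quantifier_free \<psi> \<and> \<phi> = foldr Exi xs (foldr All ys \<psi>))"


section \<open>Basic facts\<close>

lemma eval_cong: "(\<And>x. x \<in> vars t \<Longrightarrow> v x = w x) \<Longrightarrow> eval L v t = eval L w t"
proof (induction t)
  case (Meet s t)
  have "eval L v s = eval L w s" "eval L v t = eval L w t"
    using Meet by simp_all
  then show ?case by simp
next
  case (Join s t)
  have "eval L v s = eval L w s" "eval L v t = eval L w t"
    using Join by simp_all
  then show ?case by simp
qed simp

lemma sat_cong: "(\<And>x. x \<in> fv \<phi> \<Longrightarrow> v x = w x) \<Longrightarrow> sat L v \<phi> \<longleftrightarrow> sat L w \<phi>"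
proof (induction \<phi> arbitrary: v w)
  case (Eq s t)
  have "eval L v s = eval L w s" "eval L v t = eval L w t"
    using Eq by (auto intro: eval_cong)
  then show ?case by simp
next
  case (Le s t)
  have "eval L v s = eval L w s" "eval L v t = eval L w t"
    using Le by (auto intro: eval_cong)
  then show ?case by simp
next
  case (Neg \<phi>)
  have "sat L v \<phi> \<longleftrightarrow> sat L w \<phi>"
    using Neg.prems by (intro Neg.IH) simp
  then show ?case by simp
next
  case (Conj \<phi> \<psi>)
  have "sat L v \<phi> \<longleftrightarrow> sat L w \<phi>" "sat L v \<psi> \<longleftrightarrow> sat L w \<psi>"
    using Conj.prems by (auto intro!: Conj.IH)
  then show ?case by simp
next
  case (Disj \<phi> \<psi>)
  have "sat L v \<phi> \<longleftrightarrow> sat L w \<phi>" "sat L v \<psi> \<longleftrightarrow> sat L w \<psi>"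
    using Disj.prems by (auto intro!: Disj.IH)
  then show ?case by simp
next
  case (Exi x \<phi>)
  have "sat L (v(x := a)) \<phi> \<longleftrightarrow> sat L (w(x := a)) \<phi>" for a
    using Exi.prems by (intro Exi.IH) auto
  then show ?case by simp
next
  case (All x \<phi>)
  have "sat L (v(x := a)) \<phi> \<longleftrightarrow> sat L (w(x := a)) \<phi>" for a
    using All.prems by (intro All.IH) auto
  then show ?case by simp
qed

lemma true_in_iff_sat:
  assumes "sentence \<phi>" and "carrier L \<noteq> {}"
  shows "true_in L \<phi> \<longleftrightarrow> sat L v \<phi>"
proof -
  obtain a where a: "a \<in> carrier L" using assms(2) by blast
  have eq: "sat L w \<phi> \<longleftrightarrow> sat L v \<phi>" for w
    using assms(1) by (intro sat_cong) (simp add: sentence_def)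
  have "range (\<lambda>_::nat. a) \<subseteq> carrier L" using a by auto
  with eq show ?thesis unfolding true_in_def by blast
qed

lemma terms_over_simps [simp]:
  "Var x \<in> terms_over X \<longleftrightarrow> x \<in> X"
  "Meet s t \<in> terms_over X \<longleftrightarrow> s \<in> terms_over X \<and> t \<in> terms_over X"
  "Join s t \<in> terms_over X \<longleftrightarrow> s \<in> terms_over X \<and> t \<in> terms_over X"
  by (auto simp: terms_over_def)

lemma lat_cong_terms_over: "(s, t) \<in> lat_cong X \<Longrightarrow> s \<in> terms_over X \<and> t \<in> terms_over X"
  by (induction rule: lat_cong.induct) auto

lemma equiv_lat_cong: "equiv (terms_over X) (lat_cong X)"
  by (rule equivI)
    (auto simp: refl_on_def sym_def trans_def
      dest: lat_cong_terms_over intro: lat_cong.refl lat_cong.sym lat_cong.trans)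

lemma Meet_idem:
  assumes s: "s \<in> terms_over X"
  shows "(Meet s s, s) \<in> lat_cong X"
proof (rule lat_cong.trans)
  show "(Meet s s, Meet s (Join s (Meet s s))) \<in> lat_cong X"
    using s by (intro lat_cong.Meet_cong lat_cong.refl lat_cong.sym[OF lat_cong.Join_absorb])
  show "(Meet s (Join s (Meet s s)), s) \<in> lat_cong X"
    using s by (intro lat_cong.Meet_absorb) auto
qed

lemma Meet_iff_Join:
  assumes s: "s \<in> terms_over X" and t: "t \<in> terms_over X"
  shows "(Meet s t, s) \<in> lat_cong X \<longleftrightarrow> (Join s t, t) \<in> lat_cong X"
proof
  assume "(Meet s t, s) \<in> lat_cong X"
  then have "(Join s t, Join (Meet s t) t) \<in> lat_cong X"
    by (intro lat_cong.Join_cong lat_cong.refl t) (rule lat_cong.sym)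
  moreover have "(Join (Meet s t) t, Join t (Meet s t)) \<in> lat_cong X"
    using s t by (intro lat_cong.Join_comm) auto
  moreover have "(Join t (Meet s t), Join t (Meet t s)) \<in> lat_cong X"
    using s t by (intro lat_cong.Join_cong lat_cong.refl lat_cong.Meet_comm)
  moreover have "(Join t (Meet t s), t) \<in> lat_cong X"
    using s t by (intro lat_cong.Join_absorb)
  ultimately show "(Join s t, t) \<in> lat_cong X"
    by (meson lat_cong.trans)
next
  assume "(Join s t, t) \<in> lat_cong X"
  then have "(Meet s t, Meet s (Join s t)) \<in> lat_cong X"
    by (intro lat_cong.Meet_cong lat_cong.refl s) (rule lat_cong.sym)
  moreover have "(Meet s (Join s t), s) \<in> lat_cong X"
    using s t by (intro lat_cong.Meet_absorb)
  ultimately show "(Meet s t, s) \<in> lat_cong X"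
    by (rule lat_cong.trans)
qed

definition lat_class :: "'a set \<Rightarrow> 'a lterm \<Rightarrow> 'a lterm set" where
  "lat_class X t = lat_cong X `` {t}"

lemma carrier_free_lattice: "carrier (free_lattice X) = lat_class X ` terms_over X"
  by (auto simp: free_lattice_def lat_class_def quotient_def)

lemma lat_class_eq_iff:
  "s \<in> terms_over X \<Longrightarrow> t \<in> terms_over X \<Longrightarrow>
    lat_class X s = lat_class X t \<longleftrightarrow> (s, t) \<in> lat_cong X"
  unfolding lat_class_def using eq_equiv_class_iff[OF equiv_lat_cong] .

lemma le_free_lattice:
  assumes s: "s \<in> terms_over X" and t: "t \<in> terms_over X"
  shows "lat_class X s \<sqsubseteq>\<^bsub>free_lattice X\<^esub> lat_class X t \<longleftrightarrow> (Meet s t, s) \<in> lat_cong X"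
proof
  assume "lat_class X s \<sqsubseteq>\<^bsub>free_lattice X\<^esub> lat_class X t"
  then obtain s' t' where *: "(s, s') \<in> lat_cong X" "(t, t') \<in> lat_cong X"
      "(Meet s' t', s') \<in> lat_cong X"
    by (auto simp: free_lattice_def lat_class_def)
  then show "(Meet s t, s) \<in> lat_cong X"
    by (meson lat_cong.Meet_cong lat_cong.sym lat_cong.trans)
next
  assume "(Meet s t, s) \<in> lat_cong X"
  then show "lat_class X s \<sqsubseteq>\<^bsub>free_lattice X\<^esub> lat_class X t"
    using s t by (auto simp: free_lattice_def lat_class_def intro: lat_cong.refl)
qed

lemma partial_order_free_lattice: "partial_order (free_lattice X)"
proof -
  let ?F = "free_lattice X"
  have eq: "eq ?F = (=)" by (simp add: free_lattice_def)
  have refl: "x \<sqsubseteq>\<^bsub>?F\<^esub> x" if "x \<in> carrier ?F" for x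
    using that by (auto simp: carrier_free_lattice le_free_lattice Meet_idem)
  have antisym: "x = y"
    if le: "x \<sqsubseteq>\<^bsub>?F\<^esub> y" "y \<sqsubseteq>\<^bsub>?F\<^esub> x" and x: "x \<in> carrier ?F" and y: "y \<in> carrier ?F" for x y
  proof -
    obtain s t where st: "s \<in> terms_over X" "t \<in> terms_over X"
      and xy: "x = lat_class X s" "y = lat_class X t"
      using x y by (auto simp: carrier_free_lattice)
    have "(s, Meet s t) \<in> lat_cong X" and "(Meet t s, t) \<in> lat_cong X"
      using le st by (simp_all add: xy le_free_lattice lat_cong.sym)
    moreover have "(Meet s t, Meet t s) \<in> lat_cong X"
      using st by (rule lat_cong.Meet_comm)
    ultimately show ?thesis
      using st by (simp add: xy lat_class_eq_iff) (blast intro: lat_cong.trans)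
  qed
  have trans: "x \<sqsubseteq>\<^bsub>?F\<^esub> z"
    if "x \<sqsubseteq>\<^bsub>?F\<^esub> y" "y \<sqsubseteq>\<^bsub>?F\<^esub> z" and x: "x \<in> carrier ?F" and y: "y \<in> carrier ?F"
      and z: "z \<in> carrier ?F" for x y z
  proof -
    obtain s t u where stu: "s \<in> terms_over X" "t \<in> terms_over X" "u \<in> terms_over X"
      and xyz: "x = lat_class X s" "y = lat_class X t" "z = lat_class X u"
      using x y z by (auto simp: carrier_free_lattice)
    have st: "(Meet s t, s) \<in> lat_cong X" and tu: "(Meet t u, t) \<in> lat_cong X"
      using that(1,2) stu by (simp_all add: xyz le_free_lattice)
    have "(Meet s u, Meet (Meet s t) u) \<in> lat_cong X"
      using st stu by (intro lat_cong.Meet_cong lat_cong.refl) (rule lat_cong.sym)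
    moreover have "(Meet (Meet s t) u, Meet s (Meet t u)) \<in> lat_cong X"
      using stu by (intro lat_cong.Meet_assoc)
    moreover have "(Meet s (Meet t u), Meet s t) \<in> lat_cong X"
      using stu tu by (intro lat_cong.Meet_cong lat_cong.refl)
    ultimately have "(Meet s u, s) \<in> lat_cong X"
      using st by (meson lat_cong.trans)
    then show ?thesis using stu by (simp add: xyz le_free_lattice)
  qed
  show ?thesis
    by (unfold_locales; (unfold eq)?) (metis refl antisym trans)+
qed

lemma greatest_Meet:
  assumes s: "s \<in> terms_over X" and t: "t \<in> terms_over X"
  shows "greatest (free_lattice X) (lat_class X (Meet s t))
    (Lower (free_lattice X) {lat_class X s, lat_class X t})"
proof -
  interpret partial_order "free_lattice X" by (rule partial_order_free_lattice)
  have 2: "(Meet (Meet s t) t, Meet s t) \<in> lat_cong X"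
  proof (rule lat_cong.trans)
    show "(Meet (Meet s t) t, Meet s (Meet t t)) \<in> lat_cong X"
      using s t by (intro lat_cong.Meet_assoc)
    show "(Meet s (Meet t t), Meet s t) \<in> lat_cong X"
      using s t by (intro lat_cong.Meet_cong lat_cong.refl Meet_idem)
  qed
  have comm: "(Meet s t, Meet t s) \<in> lat_cong X"
    using s t by (rule lat_cong.Meet_comm)
  have 1: "(Meet (Meet s t) s, Meet s t) \<in> lat_cong X"
  proof -
    have "(Meet (Meet s t) s, Meet (Meet t s) s) \<in> lat_cong X"
      using comm s by (blast intro: lat_cong.Meet_cong lat_cong.refl)
    moreover have "(Meet (Meet t s) s, Meet t (Meet s s)) \<in> lat_cong X"
      using s t by (intro lat_cong.Meet_assoc)
    moreover have "(Meet t (Meet s s), Meet t s) \<in> lat_cong X"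
      using s t by (intro lat_cong.Meet_cong lat_cong.refl Meet_idem)
    ultimately show ?thesis
      using comm by (meson lat_cong.sym lat_cong.trans)
  qed
  have 3: "lat_class X u \<sqsubseteq>\<^bsub>free_lattice X\<^esub> lat_class X (Meet s t)"
    if u: "u \<in> terms_over X" and us: "(Meet u s, u) \<in> lat_cong X" and ut: "(Meet u t, u) \<in> lat_cong X" for u
  proof -
    have "(Meet u (Meet s t), Meet (Meet u s) t) \<in> lat_cong X"
      using u s t by (intro lat_cong.sym[OF lat_cong.Meet_assoc])
    moreover have "(Meet (Meet u s) t, Meet u t) \<in> lat_cong X"
      using us t by (intro lat_cong.Meet_cong lat_cong.refl)
    ultimately have "(Meet u (Meet s t), u) \<in> lat_cong X"
      using ut by (meson lat_cong.trans)
    then show ?thesis using u s t by (simp add: le_free_lattice)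
  qed
  show ?thesis
  proof (rule greatest_LowerI)
    fix z assume "z \<in> {lat_class X s, lat_class X t}"
    then show "lat_class X (Meet s t) \<sqsubseteq>\<^bsub>free_lattice X\<^esub> z"
      using 1 2 s t by (auto simp: le_free_lattice)
  next
    fix z assume z: "z \<in> Lower (free_lattice X) {lat_class X s, lat_class X t}"
    then obtain u where u: "u \<in> terms_over X" "z = lat_class X u"
      by (auto simp: Lower_def carrier_free_lattice)
    have "z \<sqsubseteq>\<^bsub>free_lattice X\<^esub> lat_class X s" "z \<sqsubseteq>\<^bsub>free_lattice X\<^esub> lat_class X t"
      using z s t by (auto simp: Lower_def carrier_free_lattice)
    then show "z \<sqsubseteq>\<^bsub>free_lattice X\<^esub> lat_class X (Meet s t)"
      using u s t 3 by (simp add: le_free_lattice)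
  qed (use s t in \<open>auto simp: carrier_free_lattice\<close>)
qed

lemma least_Join:
  assumes s: "s \<in> terms_over X" and t: "t \<in> terms_over X"
  shows "least (free_lattice X) (lat_class X (Join s t))
    (Upper (free_lattice X) {lat_class X s, lat_class X t})"
proof -
  interpret partial_order "free_lattice X" by (rule partial_order_free_lattice)
  have 1: "(Meet s (Join s t), s) \<in> lat_cong X"
    using s t by (rule lat_cong.Meet_absorb)
  have 2: "(Meet t (Join s t), t) \<in> lat_cong X"
  proof (rule lat_cong.trans)
    show "(Meet t (Join s t), Meet t (Join t s)) \<in> lat_cong X"
      using s t by (intro lat_cong.Meet_cong lat_cong.refl lat_cong.Join_comm)
    show "(Meet t (Join t s), t) \<in> lat_cong X"
      using s t by (rule lat_cong.Meet_absorb[rotated])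
  qed
  have 3: "lat_class X (Join s t) \<sqsubseteq>\<^bsub>free_lattice X\<^esub> lat_class X u"
    if u: "u \<in> terms_over X" and us: "(Meet s u, s) \<in> lat_cong X" and ut: "(Meet t u, t) \<in> lat_cong X" for u
  proof -
    have su: "(Join s u, u) \<in> lat_cong X" and tu: "(Join t u, u) \<in> lat_cong X"
      using us ut s t u by (simp_all add: Meet_iff_Join)
    have "(Join (Join s t) u, Join s (Join t u)) \<in> lat_cong X"
      using u s t by (intro lat_cong.Join_assoc)
    moreover have "(Join s (Join t u), Join s u) \<in> lat_cong X"
      using tu s by (intro lat_cong.Join_cong lat_cong.refl)
    ultimately have "(Join (Join s t) u, u) \<in> lat_cong X"
      using su by (meson lat_cong.trans)
    then show ?thesis using u s t by (simp add: le_free_lattice Meet_iff_Join)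
  qed
  show ?thesis
  proof (rule least_UpperI)
    fix z assume "z \<in> {lat_class X s, lat_class X t}"
    then show "z \<sqsubseteq>\<^bsub>free_lattice X\<^esub> lat_class X (Join s t)"
      using 1 2 s t by (auto simp: le_free_lattice)
  next
    fix z assume z: "z \<in> Upper (free_lattice X) {lat_class X s, lat_class X t}"
    then obtain u where u: "u \<in> terms_over X" "z = lat_class X u"
      by (auto simp: Upper_def carrier_free_lattice)
    have "lat_class X s \<sqsubseteq>\<^bsub>free_lattice X\<^esub> z" "lat_class X t \<sqsubseteq>\<^bsub>free_lattice X\<^esub> z"
      using z s t by (auto simp: Upper_def carrier_free_lattice)
    then show "lat_class X (Join s t) \<sqsubseteq>\<^bsub>free_lattice X\<^esub> z"
      using u s t 3 by (simp add: le_free_lattice)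
  qed (use s t in \<open>auto simp: carrier_free_lattice\<close>)
qed

theorem lattice_free_lattice: "lattice (free_lattice X)"
proof -
  interpret partial_order "free_lattice X" by (rule partial_order_free_lattice)
  show ?thesis
  proof
    fix x y assume "x \<in> carrier (free_lattice X)" "y \<in> carrier (free_lattice X)"
    then show "\<exists>s. least (free_lattice X) s (Upper (free_lattice X) {x, y})"
      and "\<exists>s. greatest (free_lattice X) s (Lower (free_lattice X) {x, y})"
      by (auto simp: carrier_free_lattice intro: least_Join greatest_Meet)
  qed
qed

lemma meet_free_lattice:
  assumes "s \<in> terms_over X" "t \<in> terms_over X"
  shows "lat_class X s \<sqinter>\<^bsub>free_lattice X\<^esub> lat_class X t = lat_class X (Meet s t)"
proof -
  interpret lattice "free_lattice X" by (rule lattice_free_lattice)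
  show ?thesis
    by (rule meetI)
      (use assms greatest_Meet[OF assms] greatest_unique in \<open>auto simp: carrier_free_lattice\<close>)
qed

lemma join_free_lattice:
  assumes "s \<in> terms_over X" "t \<in> terms_over X"
  shows "lat_class X s \<squnion>\<^bsub>free_lattice X\<^esub> lat_class X t = lat_class X (Join s t)"
proof -
  interpret lattice "free_lattice X" by (rule lattice_free_lattice)
  show ?thesis
    by (rule joinI)
      (use assms least_Join[OF assms] least_unique in \<open>auto simp: carrier_free_lattice\<close>)
qed

lemma (in lattice) eval_closed:
  "v \<in> X \<rightarrow> carrier L \<Longrightarrow> t \<in> terms_over X \<Longrightarrow> eval L v t \<in> carrier L"
  by (induction t) auto

lemma (in lattice) eval_lat_cong:
  assumes "(s, t) \<in> lat_cong X" and v: "v \<in> X \<rightarrow> carrier L"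
  shows "eval L v s = eval L v t"
  using assms(1)
proof (induction rule: lat_cong.induct)
  case (Meet_comm s t)
  show ?case by (simp add: meet_comm)
next
  case (Join_comm s t)
  show ?case by (simp add: join_comm)
next
  case (Meet_assoc s t u)
  then show ?case by (simp add: eval_closed[OF v] weak_meet_assoc[unfolded eq_is_equal])
next
  case (Join_assoc s t u)
  then show ?case by (simp add: eval_closed[OF v] weak_join_assoc[unfolded eq_is_equal])
next
  case (Meet_absorb s t)
  then have *: "eval L v s \<in> carrier L" "eval L v t \<in> carrier L"
    using eval_closed[OF v] by auto
  then show ?case
    by (auto intro!: le_antisym meet_left meet_le join_left)
next
  case (Join_absorb s t)
  then have *: "eval L v s \<in> carrier L" "eval L v t \<in> carrier L"
    using eval_closed[OF v] by auto
  then show ?case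
    by (auto intro!: le_antisym meet_left join_le join_left)
qed simp_all

text \<open>The universal property.\<close>

theorem free_lattice_universal:
  fixes L :: "('b, 'c) gorder_scheme"
  assumes L: "lattice L" and f: "f \<in> X \<rightarrow> carrier L"
  shows "\<exists>!h. h \<in> carrier (free_lattice X) \<rightarrow>\<^sub>E carrier L \<and>
    meet_pres (free_lattice X) L h \<and> join_pres (free_lattice X) L h \<and>
    (\<forall>x\<in>X. h (lat_class X (Var x)) = f x)"
proof -
  interpret L: lattice L by (rule L)
  let ?F = "free_lattice X"
  define h where "h = (\<lambda>A\<in>carrier ?F. eval L f (SOME t. t \<in> A))"
  have h: "h (lat_class X t) = eval L f t" if t: "t \<in> terms_over X" for t
  proof -
    have "t \<in> lat_class X t" using t by (simp add: lat_class_def lat_cong.refl)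
    then have "(SOME t'. t' \<in> lat_class X t) \<in> lat_class X t" by (rule someI)
    then have "eval L f t = eval L f (SOME t'. t' \<in> lat_class X t)"
      by (intro L.eval_lat_cong[OF _ f]) (simp add: lat_class_def)
    then show ?thesis using t by (simp add: h_def carrier_free_lattice)
  qed
  have ext: "h \<in> carrier ?F \<rightarrow>\<^sub>E carrier L"
  proof (rule PiE_I)
    fix A assume "A \<in> carrier ?F"
    then show "h A \<in> carrier L"
      using h L.eval_closed[OF f] by (auto simp: carrier_free_lattice)
  qed (simp add: h_def)
  have "meet_pres ?F L h" "join_pres ?F L h"
    unfolding meet_pres_def join_pres_def
    using lattice_free_lattice[of X] L h
    by (auto simp: carrier_free_lattice meet_free_lattice join_free_lattice)
  moreover have "\<forall>x\<in>X. h (lat_class X (Var x)) = f x"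
    by (simp add: h)
  moreover have "g = h"
    if g: "g \<in> carrier ?F \<rightarrow>\<^sub>E carrier L" "meet_pres ?F L g" "join_pres ?F L g"
      "\<forall>x\<in>X. g (lat_class X (Var x)) = f x" for g
  proof -
    have "g (lat_class X t) = eval L f t" if "t \<in> terms_over X" for t
      using that
    proof (induction t)
      case (Var x)
      then show ?case using g(4) by simp
    next
      case (Meet s t)
      then show ?case using g(2)
        by (auto simp: meet_pres_def carrier_free_lattice meet_free_lattice[symmetric])
    next
      case (Join s t)
      then show ?case using g(3)
        by (auto simp: join_pres_def carrier_free_lattice join_free_lattice[symmetric])
    qed
    then show "g = h"
      by (intro PiE_ext[OF g(1) ext]) (auto simp: carrier_free_lattice h)
  qed
  ultimately show ?thesis using ext by (intro ex1I[of _ h]) blast+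
qed

end

theory Submission
  imports Defs
begin

text \<open>
  The sentence for \<open>n\<close> says that some \<open>x\<^sub>0, \<dots>, x\<^sub>n\<^sub>-\<^sub>1\<close> split the lattice like free
  generators do: for every \<open>S\<close>, each \<open>u\<close> lies above \<open>\<Sqinter>\<^sub>i\<^sub>\<in>\<^sub>S x\<^sub>i\<close> or below
  \<open>\<Squnion>\<^sub>i\<^sub>\<notin>\<^sub>S x\<^sub>i\<close>.
  A homomorphism \<open>h\<close> to the two-element lattice has a type \<open>{i. h x\<^sub>i = 1} \<subseteq> {..<n}\<close>.
  If the type of \<open>h'\<close> is contained in the type of \<open>h\<close>, then taking \<open>S\<close> to be the type of \<open>h\<close> shows
  that no \<open>u\<close> has \<open>h u = 0\<close> and \<open>h' u = 1\<close>. Homomorphisms from the free lattice on \<open>m\<close> generators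
  correspond to subsets of \<open>{..<m}\<close>, and for \<open>h, h'\<close> given by incomparable subsets such a \<open>u\<close>
  exists. So the sentence turns an antichain of subsets of \<open>{..<m}\<close> into an antichain of the same
  size of subsets of \<open>{..<n}\<close>. For \<open>n < m\<close> this fails for suitable antichains: adding \<open>n\<close> to each member
  of a largest antichain of subsets of \<open>{..<n}\<close> and adjoining the set \<open>{..<n}\<close> gives a larger one,
  unless \<open>{..<n}\<close> is its only member, when \<open>{{n}, {..<n}}\<close> is larger.
\<close>

section \<open>Antichains of finite sets\<close>

definition antichain :: "'a set set \<Rightarrow> bool" where
  "antichain \<A> \<longleftrightarrow> (\<forall>A\<in>\<A>. \<forall>B\<in>\<A>. A \<subseteq> B \<longrightarrow> A = B)"

text \<open>The clause \<open>{} \<notin> \<B>\<close> is wanted because each member of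
  \<open>\<B>\<close> will be turned into the meet of its generators, and there is no empty
  meet.\<close>

lemma larger_antichain:
  fixes n :: nat
  assumes "1 \<le> n"
  obtains \<B> where "\<B> \<subseteq> Pow {..n}" "antichain \<B>" "{} \<notin> \<B>"
    "\<And>\<A>. \<A> \<subseteq> Pow {..<n} \<Longrightarrow> antichain \<A> \<Longrightarrow> card \<A> < card \<B>"
proof -
  let ?P = "\<lambda>\<A>. \<A> \<subseteq> Pow {..<n} \<and> antichain \<A>"
  have "?P {}" by (simp add: antichain_def)
  moreover have "\<forall>\<A>. ?P \<A> \<longrightarrow> card \<A> < Suc (card (Pow {..<n}))"
    by (intro allI impI le_imp_less_Suc card_mono) auto
  ultimately obtain \<A> where \<A>: "?P \<A>" and max: "\<And>\<A>'. ?P \<A>' \<Longrightarrow> card \<A>' \<le> card \<A>"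
    using ex_has_greatest_nat[of ?P "{}" card "Suc (card (Pow {..<n}))"] by blast
  show ?thesis
  proof (cases "{..<n} \<in> \<A>")
    case True
    then have "\<A> = {{..<n}}" using \<A> by (auto simp: antichain_def)
    \<comment> \<open>The elements \<open>n\<close> and \<open>0\<close> witness that the two sets
      are incomparable; \<open>0\<close> needs \<open>1 \<le> n\<close>.\<close>
    moreover have *: "\<not> {n} \<subseteq> {..<n}" "0 \<in> {..<n}" "0 \<notin> {n}" using assms by auto
    moreover from this have "{n} \<noteq> {..<n}" by blast
    ultimately have larger: "card \<A> < card {{n}, {..<n}}" "antichain {{n}, {..<n}}"
      by (simp, unfold antichain_def, blast)
    show ?thesis
    proof (rule that)
      show "{{n}, {..<n}} \<subseteq> Pow {..n}" using \<A> by auto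
      show "{} \<notin> {{n}, {..<n}}" using *(2) by blast
      show "card \<A>' < card {{n}, {..<n}}" if "\<A>' \<subseteq> Pow {..<n}" "antichain \<A>'" for \<A>'
        using max[of \<A>'] that larger(1) by linarith
    qed (fact larger(2))
  next
    case False
    have n: "n \<notin> A" if "A \<in> \<A>" for A using \<A> that by auto
    have "inj_on (insert n) \<A>" using n by (intro inj_onI) (metis Diff_insert_absorb)
    then have "card (insert n ` \<A>) = card \<A>" by (rule card_image)
    moreover have "finite \<A>" using \<A> by (meson finite_Pow_iff finite_lessThan finite_subset)
    moreover have "{..<n} \<notin> insert n ` \<A>" by (metis imageE insertI1 lessThan_iff nat_neq_iff)
    ultimately have "card \<A> < card (insert {..<n} (insert n ` \<A>))" by simp
    moreover have "antichain (insert {..<n} (insert n ` \<A>))"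
      unfolding antichain_def
    proof (intro ballI impI)
      fix A B assume AB: "A \<in> insert {..<n} (insert n ` \<A>)" "B \<in> insert {..<n} (insert n ` \<A>)" "A \<subseteq> B"
      consider "A = {..<n}" "B = {..<n}"
        | B' where "A = {..<n}" "B' \<in> \<A>" "B = insert n B'"
        | A' where "A' \<in> \<A>" "A = insert n A'" "B = {..<n}"
        | A' B' where "A' \<in> \<A>" "A = insert n A'" "B' \<in> \<A>" "B = insert n B'"
        using AB by auto
      then show "A = B"
      proof cases
        \<comment> \<open>As \<open>n\<close> is not in \<open>{..<n}\<close>, the inclusion forces
          \<open>B' = {..<n}\<close>, which is not in \<open>\<A>\<close>.\<close>
        case 2
        then have "{..<n} \<subseteq> B'" using AB by (auto simp: subset_insert)
        then have "B' = {..<n}" using \<A> 2 by blast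
        then show ?thesis using False 2 by blast
      next
        case 4
        then have "A' \<subseteq> B'" using AB n by blast
        then show ?thesis using \<A> 4 by (auto simp: antichain_def)
      qed (use AB in auto)
    qed
    ultimately have larger: "card \<A> < card (insert {..<n} (insert n ` \<A>))"
        "antichain (insert {..<n} (insert n ` \<A>))" by blast+
    have "0 \<in> {..<n}" using assms by simp
    show ?thesis
    proof (rule that)
      show "insert {..<n} (insert n ` \<A>) \<subseteq> Pow {..n}"
        using \<A> less_imp_le_nat by fastforce
      show "{} \<notin> insert {..<n} (insert n ` \<A>)" using \<open>0 \<in> {..<n}\<close> by blast
      show "card \<A>' < card (insert {..<n} (insert n ` \<A>))" if "\<A>' \<subseteq> Pow {..<n}" "antichain \<A>'" for \<A>'
        using max[of \<A>'] that larger(1) by linarith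
    qed (fact larger(2))
  qed
qed


section \<open>Induction on elements, and homomorphisms to the two-element lattice\<close>

lemma free_lattice_induct [consumes 1, case_names Var meet join]:
  assumes "A \<in> carrier (free_lattice X)"
    and "\<And>x. x \<in> X \<Longrightarrow> P (lat_class X (Var x))"
    and "\<And>A B. A \<in> carrier (free_lattice X) \<Longrightarrow> B \<in> carrier (free_lattice X) \<Longrightarrow> P A \<Longrightarrow> P B \<Longrightarrow>
      P (A \<sqinter>\<^bsub>free_lattice X\<^esub> B)"
    and "\<And>A B. A \<in> carrier (free_lattice X) \<Longrightarrow> B \<in> carrier (free_lattice X) \<Longrightarrow> P A \<Longrightarrow> P B \<Longrightarrow>
      P (A \<squnion>\<^bsub>free_lattice X\<^esub> B)"
  shows "P A"
proof -
  have "P (lat_class X t)" if "t \<in> terms_over X" for t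
    using that
  proof (induction t)
    case (Meet s t)
    then show ?case
      using assms(3)[of "lat_class X s" "lat_class X t"]
      by (simp add: carrier_free_lattice meet_free_lattice)
  next
    case (Join s t)
    then show ?case
      using assms(4)[of "lat_class X s" "lat_class X t"]
      by (simp add: carrier_free_lattice join_free_lattice)
  qed (simp add: assms(2))
  then show ?thesis using assms(1) by (auto simp: carrier_free_lattice)
qed

text \<open>The homomorphism to the two-element lattice that sends exactly the variables in
  \<open>p\<close> to 1.\<close>

primrec val :: "'a set \<Rightarrow> 'a lterm \<Rightarrow> bool" where
  "val p (Var x) \<longleftrightarrow> x \<in> p"
| "val p (Meet s t) \<longleftrightarrow> val p s \<and> val p t"
| "val p (Join s t) \<longleftrightarrow> val p s \<or> val p t"

lemma val_lat_cong: "(s, t) \<in> lat_cong X \<Longrightarrow> val p s = val p t"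
  by (induction rule: lat_cong.induct) auto

text \<open>By \<open>val_lat_cong\<close> all representatives agree, so asking for one of them
  avoids a choice.\<close>

definition class_val :: "'a set \<Rightarrow> 'a lterm set \<Rightarrow> bool" where
  "class_val p A \<longleftrightarrow> (\<exists>t\<in>A. val p t)"

lemma class_val_lat_class: "t \<in> terms_over X \<Longrightarrow> class_val p (lat_class X t) = val p t"
  by (auto simp: class_val_def lat_class_def dest: val_lat_cong intro: lat_cong.refl)

lemma class_val_meet:
  "A \<in> carrier (free_lattice X) \<Longrightarrow> B \<in> carrier (free_lattice X) \<Longrightarrow>
    class_val p (A \<sqinter>\<^bsub>free_lattice X\<^esub> B) \<longleftrightarrow> class_val p A \<and> class_val p B"
  by (auto simp: carrier_free_lattice meet_free_lattice class_val_lat_class)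

lemma class_val_join:
  "A \<in> carrier (free_lattice X) \<Longrightarrow> B \<in> carrier (free_lattice X) \<Longrightarrow>
    class_val p (A \<squnion>\<^bsub>free_lattice X\<^esub> B) \<longleftrightarrow> class_val p A \<or> class_val p B"
  by (auto simp: carrier_free_lattice join_free_lattice class_val_lat_class)

lemma class_val_mono:
  assumes "A \<sqsubseteq>\<^bsub>free_lattice X\<^esub> B" "A \<in> carrier (free_lattice X)" "B \<in> carrier (free_lattice X)"
    and "class_val p A"
  shows "class_val p B"
  using assms
  by (auto simp: carrier_free_lattice le_free_lattice class_val_lat_class dest!: val_lat_cong[where p = p])

text \<open>Homomorphisms commute with evaluation, so the two-valued image of a term depends only on
  which variables are sent to 1. This turns inequalities between values into statements about
  types.\<close>

lemma class_val_eval: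
  assumes "v \<in> V \<rightarrow> carrier (free_lattice X)" "t \<in> terms_over V"
  shows "class_val p (eval (free_lattice X) v t) = val {x \<in> V. class_val p (v x)} t"
  using assms(2)
proof (induction t)
  interpret lattice "free_lattice X" by (rule lattice_free_lattice)
  case (Meet s t)
  then show ?case by (simp add: class_val_meet eval_closed[OF assms(1)])
next
  interpret lattice "free_lattice X" by (rule lattice_free_lattice)
  case (Join s t)
  then show ?case by (simp add: class_val_join eval_closed[OF assms(1)])
qed simp


section \<open>Iterated meets and joins of variables\<close>

definition meets :: "'a list \<Rightarrow> 'a lterm \<Rightarrow> 'a lterm" where
  "meets xs t = foldr (\<lambda>x. Meet (Var x)) xs t"

text \<open>Terms have no empty meet or join, so here and in \<open>meets\<close> the fold ends in a
  given term \<open>t\<close>.\<close>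

definition joins :: "'a list \<Rightarrow> 'a lterm \<Rightarrow> 'a lterm" where
  "joins xs t = foldr (\<lambda>x. Join (Var x)) xs t"

lemma vars_meets: "vars (meets xs t) = set xs \<union> vars t"
  by (induction xs) (auto simp: meets_def)

lemma vars_joins: "vars (joins xs t) = set xs \<union> vars t"
  by (induction xs) (auto simp: joins_def)

lemma val_meets: "val p (meets xs t) \<longleftrightarrow> set xs \<subseteq> p \<and> val p t"
  by (induction xs) (auto simp: meets_def)

lemma val_joins: "val p (joins xs t) \<longleftrightarrow> set xs \<inter> p \<noteq> {} \<or> val p t"
  by (induction xs) (auto simp: joins_def)

lemma (in lattice) eval_meets_le:
  assumes "v \<in> V \<rightarrow> carrier L" "meets xs t \<in> terms_over V" "x \<in> set xs"
  shows "eval L v (meets xs t) \<sqsubseteq> v x"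
  using assms(2,3)
proof (induction xs)
  case (Cons y xs)
  have y: "v y \<in> carrier L" and r: "eval L v (meets xs t) \<in> carrier L" and x: "v x \<in> carrier L"
    using Cons.prems assms(1)
    by (auto simp: terms_over_def vars_meets intro!: eval_closed[OF assms(1)])
  have *: "eval L v (meets (y # xs) t) = v y \<sqinter> eval L v (meets xs t)" by (simp add: meets_def)
  show ?case
  proof (cases "x = y")
    case True
    then show ?thesis using y r by (simp add: * meet_left)
  next
    case False
    then have "eval L v (meets xs t) \<sqsubseteq> v x"
      using Cons by (auto simp: terms_over_def vars_meets)
    then show ?thesis using y r x by (auto simp: * intro: le_trans[OF meet_right])
  qed
qed simp

lemma (in lattice) eval_joins_ge:
  assumes "v \<in> V \<rightarrow> carrier L" "joins xs t \<in> terms_over V" "x \<in> set xs"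
  shows "v x \<sqsubseteq> eval L v (joins xs t)"
  using assms(2,3)
proof (induction xs)
  case (Cons y xs)
  have y: "v y \<in> carrier L" and r: "eval L v (joins xs t) \<in> carrier L" and x: "v x \<in> carrier L"
    using Cons.prems assms(1)
    by (auto simp: terms_over_def vars_joins intro!: eval_closed[OF assms(1)])
  have *: "eval L v (joins (y # xs) t) = v y \<squnion> eval L v (joins xs t)" by (simp add: joins_def)
  show ?case
  proof (cases "x = y")
    case True
    then show ?thesis using y r by (simp add: * join_left)
  next
    case False
    then have "v x \<sqsubseteq> eval L v (joins xs t)"
      using Cons by (auto simp: terms_over_def vars_joins)
    then show ?thesis using y r x by (auto simp: * intro: le_trans[OF _ join_right])
  qed
qed simp

section \<open>The sentence and its logical form\<close>

abbreviation bot_term :: "nat \<Rightarrow> nat lterm" where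
  "bot_term n \<equiv> meets [0..<n] (Var 0)"

text \<open>Here and in \<open>bot_term\<close>, the final \<open>Var 0\<close> changes nothing when
  \<open>1 \<le> n\<close>, since \<open>0\<close> is then in the list.\<close>

abbreviation top_term :: "nat \<Rightarrow> nat lterm" where
  "top_term n \<equiv> joins [0..<n] (Var 0)"

text \<open>
  The elements \<open>x\<^sub>i\<close> are the variables \<open>i < n\<close>, and \<open>u\<close> is the variable \<open>n\<close>. The bounds serve as
  the empty meet and the empty join.
\<close>

definition split_fm :: "nat \<Rightarrow> nat list \<Rightarrow> fm" where
  "split_fm n S = Disj (Le (meets S (top_term n)) (Var n))
    (Le (Var n) (joins (filter (\<lambda>i. i \<notin> set S) [0..<n]) (bot_term n)))"

text \<open>The last two conjuncts are the splitting condition for the full and the empty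
  \<open>S\<close>, where one alternative is lost because its join or meet is empty.\<close>

definition matrix_fm :: "nat \<Rightarrow> fm" where
  "matrix_fm n = foldr (\<lambda>S. Conj (split_fm n S)) (subseqs [0..<n])
    (Conj (Le (bot_term n) (Var n)) (Le (Var n) (top_term n)))"

definition generators_fm :: "nat \<Rightarrow> fm" where
  "generators_fm n = foldr Exi [0..<n] (foldr All [n] (matrix_fm n))"

lemma sat_foldr_Conj:
  "sat L v (foldr (\<lambda>x. Conj (f x)) xs \<phi>) \<longleftrightarrow> (\<forall>x\<in>set xs. sat L v (f x)) \<and> sat L v \<phi>"
  by (induction xs) auto

lemma fv_foldr_Conj: "fv (foldr (\<lambda>x. Conj (f x)) xs \<phi>) = (\<Union>x\<in>set xs. fv (f x)) \<union> fv \<phi>"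
  by (induction xs) auto

lemma positive_foldr_Conj:
  "positive (foldr (\<lambda>x. Conj (f x)) xs \<phi>) \<longleftrightarrow> (\<forall>x\<in>set xs. positive (f x)) \<and> positive \<phi>"
  by (induction xs) auto

lemma quantifier_free_foldr_Conj:
  "quantifier_free (foldr (\<lambda>x. Conj (f x)) xs \<phi>) \<longleftrightarrow>
    (\<forall>x\<in>set xs. quantifier_free (f x)) \<and> quantifier_free \<phi>"
  by (induction xs) auto

lemma fv_foldr_Exi: "fv (foldr Exi xs \<phi>) = fv \<phi> - set xs"
  by (induction xs) auto

lemma positive_foldr_Exi: "positive (foldr Exi xs \<phi>) \<longleftrightarrow> positive \<phi>"
  by (induction xs) auto

lemma sat_foldr_Exi:
  "sat L v (foldr Exi xs \<phi>) \<longleftrightarrow>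
    (\<exists>w. w \<in> set xs \<rightarrow> carrier L \<and> (\<forall>x. x \<notin> set xs \<longrightarrow> w x = v x) \<and> sat L w \<phi>)"
proof (induction xs arbitrary: v)
  case Nil
  have "w = v" if "\<forall>x. w x = v x" for w using that by auto
  then show ?case by auto
next
  case (Cons y xs)
  show ?case
  proof
    assume "sat L v (foldr Exi (y # xs) \<phi>)"
    then obtain a w where a: "a \<in> carrier L" and w: "w \<in> set xs \<rightarrow> carrier L"
        "\<forall>x. x \<notin> set xs \<longrightarrow> w x = (v(y := a)) x" "sat L w \<phi>"
      using Cons.IH by auto
    \<comment> \<open>If \<open>y\<close> is quantified again in \<open>xs\<close>, its value comes
      from the inner block; otherwise it is \<open>a\<close>.\<close>
    have "w y \<in> carrier L" using a w by (cases "y \<in> set xs") auto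
    with w show "\<exists>w. w \<in> set (y # xs) \<rightarrow> carrier L \<and> (\<forall>x. x \<notin> set (y # xs) \<longrightarrow> w x = v x) \<and> sat L w \<phi>"
      by (intro exI[of _ w]) auto
  next
    assume "\<exists>w. w \<in> set (y # xs) \<rightarrow> carrier L \<and> (\<forall>x. x \<notin> set (y # xs) \<longrightarrow> w x = v x) \<and> sat L w \<phi>"
    then obtain w where w: "w \<in> set (y # xs) \<rightarrow> carrier L"
        "\<forall>x. x \<notin> set (y # xs) \<longrightarrow> w x = v x" "sat L w \<phi>" by blast
    then have "sat L (v(y := w y)) (foldr Exi xs \<phi>)"
      unfolding Cons.IH by (intro exI[of _ w]) auto
    then show "sat L v (foldr Exi (y # xs) \<phi>)" using w(1) by auto
  qed
qed

lemma in_subseqs_subset: "S \<in> set (subseqs xs) \<Longrightarrow> set S \<subseteq> set xs"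
  by (metis PowD imageI subseqs_powset)

lemma subset_in_subseqs:
  assumes "T \<subseteq> set xs"
  obtains S where "S \<in> set (subseqs xs)" "set S = T"
  using assms subseqs_powset[of xs] by (metis PowI imageE)

lemma sentence_generators_fm: "1 \<le> n \<Longrightarrow> sentence (generators_fm n)"
  using in_subseqs_subset[of _ "[0..<n]"]
  by (force simp: sentence_def generators_fm_def fv_foldr_Exi matrix_fm_def fv_foldr_Conj
      split_fm_def vars_meets vars_joins)

lemma positive_generators_fm: "positive (generators_fm n)"
  by (simp add: generators_fm_def positive_foldr_Exi matrix_fm_def positive_foldr_Conj split_fm_def)

lemma exists_forall_generators_fm: "exists_forall (generators_fm n)"
  unfolding exists_forall_def generators_fm_def
  by (intro exI[of _ "[0..<n]"] exI[of _ "[n]"] exI[of _ "matrix_fm n"])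
    (simp add: matrix_fm_def quantifier_free_foldr_Conj split_fm_def)

lemma carrier_FL_nonempty: "1 \<le> n \<Longrightarrow> carrier (FL n) \<noteq> {}"
  using terms_over_simps(1)[of 0 "{..<n}"]
  by (auto simp: carrier_free_lattice simp del: terms_over_simps)

text \<open>A sentence may be tested at one arbitrary assignment \<open>v\<close>. The matrix reads
  only variables up to \<open>n\<close>, so the witness \<open>w\<close> need not agree with
  \<open>v\<close> elsewhere.\<close>

lemma true_in_generators_fm_iff:
  assumes "1 \<le> n" "1 \<le> m"
  shows "true_in (FL m) (generators_fm n) \<longleftrightarrow>
    (\<exists>w. w \<in> {..<n} \<rightarrow> carrier (FL m) \<and>
      (\<forall>u\<in>carrier (FL m). sat (FL m) (w(n := u)) (matrix_fm n)))"
  (is "_ \<longleftrightarrow> (\<exists>w. ?P w)")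
proof -
  define v :: "nat \<Rightarrow> nat lterm set" where "v = undefined"
  have "true_in (FL m) (generators_fm n) \<longleftrightarrow> (\<exists>w. (\<forall>x. x \<notin> {..<n} \<longrightarrow> w x = v x) \<and> ?P w)"
    unfolding true_in_iff_sat[OF sentence_generators_fm[OF assms(1)] carrier_FL_nonempty[OF assms(2)], of v]
    by (auto simp: generators_fm_def sat_foldr_Exi atLeast0LessThan)
  moreover have "\<exists>w. (\<forall>x. x \<notin> {..<n} \<longrightarrow> w x = v x) \<and> ?P w" if w: "?P w" for w
  proof -
    let ?w = "\<lambda>x. if x < n then w x else v x"
    have fv: "fv (matrix_fm n) \<subseteq> {..n}"
      using sentence_generators_fm[OF assms(1)]
      by (auto simp: sentence_def generators_fm_def fv_foldr_Exi)
    have "sat (FL m) (?w(n := u)) (matrix_fm n) \<longleftrightarrow> sat (FL m) (w(n := u)) (matrix_fm n)" for u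
      by (rule sat_cong) (use fv in auto)
    with w show ?thesis by (intro exI[of _ ?w]) auto
  qed
  ultimately show ?thesis by blast
qed

section \<open>Truth and falsity in free lattices\<close>

lemma generators_fm_true:
  assumes "1 \<le> n"
  shows "true_in (FL n) (generators_fm n)"
proof -
  interpret lattice "FL n" by (rule lattice_free_lattice)
  \<comment> \<open>The free generators witness the existential block.\<close>
  define w where "w i = lat_class {..<n} (Var i)" for i
  have w: "w i \<in> carrier (FL n)" if "i < n" for i
    using that by (auto simp: w_def carrier_free_lattice)
  have "sat (FL n) (w(n := u)) (matrix_fm n)" if u: "u \<in> carrier (FL n)" for u
  proof -
    define v where "v = w(n := u)"
    have v_simps: "v n = u" "\<And>x. x < n \<Longrightarrow> v x = lat_class {..<n} (Var x)"
      by (auto simp: v_def w_def)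
    have v: "v \<in> {..<n} \<rightarrow> carrier (FL n)" using w by (auto simp: v_def)
    note closed = eval_closed[OF v]
    note le = eval_meets_le[OF v] and ge = eval_joins_ge[OF v]
    have bot: "bot_term n \<in> terms_over {..<n}" and top: "top_term n \<in> terms_over {..<n}"
      using assms by (auto simp: terms_over_def vars_meets vars_joins)
    have "eval (FL n) v (bot_term n) \<sqsubseteq>\<^bsub>FL n\<^esub> u"
      using u
    proof (induction rule: free_lattice_induct)
      case (Var x)
      then show ?case using le[OF bot, of x] by (simp add: v_simps)
    next
      case (meet A B)
      then show ?case by (simp add: meet_le closed[OF bot])
    next
      case (join A B)
      then show ?case using le_trans[OF _ join_left[of A B]] by (simp add: closed[OF bot])
    qed
    moreover have "u \<sqsubseteq>\<^bsub>FL n\<^esub> eval (FL n) v (top_term n)"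
      using u
    proof (induction rule: free_lattice_induct)
      case (Var x)
      then show ?case using ge[OF top, of x] by (simp add: v_simps)
    next
      case (meet A B)
      then show ?case using le_trans[OF meet_left[of A B]] by (simp add: closed[OF top])
    next
      case (join A B)
      then show ?case by (simp add: join_le closed[OF top])
    qed
    moreover have "sat (FL n) v (split_fm n S)" if "S \<in> set (subseqs [0..<n])" for S
    proof -
      have S: "set S \<subseteq> {..<n}" using in_subseqs_subset[OF that] by auto
      let ?s = "meets S (top_term n)"
      let ?t = "joins (filter (\<lambda>i. i \<notin> set S) [0..<n]) (bot_term n)"
      have s: "?s \<in> terms_over {..<n}" and t: "?t \<in> terms_over {..<n}"
        using assms S by (auto simp: terms_over_def vars_meets vars_joins)
      \<comment> \<open>A generator in \<open>S\<close> is above \<open>?s\<close>, any other is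
        below \<open>?t\<close>. For \<open>A\<close> and \<open>B\<close>, either both lie on the
        same side, as do their meet and join, or the meet goes with the one below \<open>?t\<close>
        and the join with the one above \<open>?s\<close>.\<close>
      have "eval (FL n) v ?s \<sqsubseteq>\<^bsub>FL n\<^esub> u \<or> u \<sqsubseteq>\<^bsub>FL n\<^esub> eval (FL n) v ?t"
        using u
      proof (induction rule: free_lattice_induct)
        case (Var x)
        then show ?case using le[OF s, of x] ge[OF t, of x] by (auto simp: v_simps)
      next
        case (meet A B)
        then show ?case
          using le_trans[OF meet_left[of A B], of "eval (FL n) v ?t"]
            le_trans[OF meet_right[of A B], of "eval (FL n) v ?t"]
          by (auto simp: closed[OF s] closed[OF t] intro: meet_le)
      next
        case (join A B)
        then show ?case
          using le_trans[OF _ join_left[of A B], of "eval (FL n) v ?s"]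
            le_trans[OF _ join_right[of A B], of "eval (FL n) v ?s"]
          by (auto simp: closed[OF s] closed[OF t] intro: join_le)
      qed
      then show ?thesis by (simp add: split_fm_def v_simps)
    qed
    ultimately have "sat (FL n) v (matrix_fm n)"
      unfolding matrix_fm_def sat_foldr_Conj by (simp add: v_simps)
    then show ?thesis by (simp add: v_def)
  qed
  moreover have "w \<in> {..<n} \<rightarrow> carrier (FL n)" using w by auto
  ultimately show ?thesis using assms by (auto simp: true_in_generators_fm_iff)
qed

lemma generators_fm_false:
  assumes n: "1 \<le> n" and m: "n < m"
  shows "\<not> true_in (FL m) (generators_fm n)"
proof
  interpret lattice "FL m" by (rule lattice_free_lattice)
  assume "true_in (FL m) (generators_fm n)"
  then obtain w where w: "w \<in> {..<n} \<rightarrow> carrier (FL m)"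
      "\<And>u. u \<in> carrier (FL m) \<Longrightarrow> sat (FL m) (w(n := u)) (matrix_fm n)"
    using true_in_generators_fm_iff[of n m] n m by (metis less_imp_le_nat order_trans)
  define type where "type p = {i. i < n \<and> class_val p (w i)}" for p
  obtain \<B> where \<B>: "\<B> \<subseteq> Pow {..n}" "antichain \<B>" "{} \<notin> \<B>"
      and card: "\<And>\<A>. \<A> \<subseteq> Pow {..<n} \<Longrightarrow> antichain \<A> \<Longrightarrow> card \<A> < card \<B>"
    using larger_antichain[OF n] by blast
  \<comment> \<open>This gives at once that \<open>type\<close> is injective on \<open>\<B>\<close>
    and that the image is an antichain.\<close>
  have reflect: "q = p" if p: "p \<in> \<B>" and q: "q \<in> \<B>" and qp: "type q \<subseteq> type p" for p q
  proof (rule ccontr)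
    assume "q \<noteq> p"
    then have not_sub: "\<not> q \<subseteq> p" using \<B>(2) p q by (auto simp: antichain_def)
    have "finite q" using \<B>(1) q by (meson PowD finite_atMost finite_subset subsetD)
    then obtain xs where xs: "set xs = q" using finite_list by blast
    obtain x where x: "x \<in> q" using \<B>(3) q by fastforce
    \<comment> \<open>The meet of the generators in \<open>q\<close> separates: \<open>q\<close>
      sends it to 1, and \<open>p\<close> to 0 since \<open>q\<close> is not contained in
      \<open>p\<close>. The choice \<open>x \<in> q\<close> makes the final term harmless.\<close>
    let ?u = "meets xs (Var x)"
    define u where "u = lat_class {..<m} ?u"
    have tu: "?u \<in> terms_over {..<m}"
      using xs x \<B>(1) q m by (fastforce simp: terms_over_def vars_meets)
    then have u: "u \<in> carrier (FL m)" by (auto simp: u_def carrier_free_lattice)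
    have up: "\<not> class_val p u" and uq: "class_val q u"
      using tu xs x not_sub by (auto simp: u_def class_val_lat_class val_meets)
    define v where "v = w(n := u)"
    have v_simps: "v n = u" "\<And>i. i < n \<Longrightarrow> v i = w i" by (auto simp: v_def)
    have v: "v \<in> {..<n} \<rightarrow> carrier (FL m)" using w(1) by (auto simp: Pi_iff v_simps)
    have "type p \<subseteq> set [0..<n]" by (auto simp: type_def)
    then obtain S where S: "S \<in> set (subseqs [0..<n])" "set S = type p"
      using subset_in_subseqs by metis
    have S_subset: "set S \<subseteq> {..<n}" unfolding S(2) type_def by blast
    let ?s = "meets S (top_term n)"
    let ?t = "joins (filter (\<lambda>i. i \<notin> set S) [0..<n]) (bot_term n)"
    have terms: "bot_term n \<in> terms_over {..<n}" "top_term n \<in> terms_over {..<n}"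
        "?s \<in> terms_over {..<n}" "?t \<in> terms_over {..<n}"
      using n S_subset by (auto simp: terms_over_def vars_meets vars_joins)
    note closed = terms[THEN eval_closed[OF v]]
    have "{i \<in> {..<n}. class_val r (v i)} = type r" for r
      by (auto simp: type_def v_simps)
    note eval = terms[THEN class_val_eval[OF v], unfolded this val_meets val_joins]
    have bounds: "eval (FL m) v (bot_term n) \<sqsubseteq>\<^bsub>FL m\<^esub> u" "u \<sqsubseteq>\<^bsub>FL m\<^esub> eval (FL m) v (top_term n)"
      and split: "eval (FL m) v ?s \<sqsubseteq>\<^bsub>FL m\<^esub> u \<or> u \<sqsubseteq>\<^bsub>FL m\<^esub> eval (FL m) v ?t"
      using w(2)[OF u] S(1)
      unfolding v_def[symmetric] matrix_fm_def sat_foldr_Conj split_fm_def by (simp_all add: v_simps)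
    have type_subset: "type p \<subseteq> {..<n}" "type q \<subseteq> {..<n}" by (auto simp: type_def)
    \<comment> \<open>The bounds exclude a full \<open>type p\<close> and an empty
      \<open>type q\<close>. With \<open>type q \<subseteq> type p\<close>, the final term
      \<open>top_term n\<close> of \<open>?s\<close> is then 1 under \<open>p\<close>, and
      \<open>bot_term n\<close> in \<open>?t\<close> is 0 under \<open>q\<close>.\<close>
    have "\<not> class_val p (eval (FL m) v (bot_term n))"
      using class_val_mono[OF bounds(1) closed(1) u] up by blast
    then have p_not_full: "\<not> {..<n} \<subseteq> type p"
      using n unfolding eval set_upt atLeast0LessThan val.simps
      by (metis lessThan_iff less_le_trans subsetD zero_less_one)
    have "class_val q (eval (FL m) v (top_term n))"
      using class_val_mono[OF bounds(2) u closed(2)] uq by blast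
    then have q_nonempty: "type q \<noteq> {}" unfolding eval by auto
    \<comment> \<open>Both alternatives now fail by monotonicity: \<open>p\<close> sends
      \<open>?s\<close> to 1 but \<open>u\<close> to 0, and \<open>q\<close> sends \<open>u\<close>
      to 1 but \<open>?t\<close> to 0.\<close>
    have "class_val p (eval (FL m) v ?s)"
      using q_nonempty qp S(2) type_subset unfolding eval by (auto simp: atLeast0LessThan)
    then have "\<not> eval (FL m) v ?s \<sqsubseteq>\<^bsub>FL m\<^esub> u"
      using up class_val_mono closed(3) u by blast
    moreover have "\<not> class_val q (eval (FL m) v ?t)"
      using p_not_full S(2) qp unfolding eval by (auto simp: atLeast0LessThan)
    then have "\<not> u \<sqsubseteq>\<^bsub>FL m\<^esub> eval (FL m) v ?t"
      using uq class_val_mono closed(4) u by blast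
    ultimately show False using split by blast
  qed
  have "inj_on type \<B>" using reflect by (intro inj_onI) blast
  then have "card (type ` \<B>) = card \<B>" by (rule card_image)
  moreover have "antichain (type ` \<B>)" using reflect by (auto simp: antichain_def)
  moreover have "type ` \<B> \<subseteq> Pow {..<n}" by (auto simp: type_def)
  ultimately show False using card[of "type ` \<B>"] by linarith
qed

theorem theorem1p4:
  shows "(\<forall>n\<ge>1. \<exists>\<phi>. sentence \<phi> \<and> positive \<phi> \<and> exists_forall \<phi> \<and>
            true_in (FL n) \<phi> \<and> \<not> true_in (FL (n + 1)) \<phi>) \<and>
         (\<forall>m\<ge>1. \<forall>n\<ge>1. m \<noteq> n \<longrightarrow>
            (\<exists>\<phi>. sentence \<phi> \<and> positive \<phi> \<and> true_in (FL m) \<phi> \<noteq> true_in (FL n) \<phi>))"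
proof (intro conjI allI impI)
  fix n :: nat assume "1 \<le> n"
  then show "\<exists>\<phi>. sentence \<phi> \<and> positive \<phi> \<and> exists_forall \<phi> \<and>
      true_in (FL n) \<phi> \<and> \<not> true_in (FL (n + 1)) \<phi>"
    using sentence_generators_fm positive_generators_fm exists_forall_generators_fm
      generators_fm_true generators_fm_false[of n "n + 1"]
    by (intro exI[of _ "generators_fm n"]) simp
next
  fix m n :: nat assume "1 \<le> m" "1 \<le> n" "m \<noteq> n"
  \<comment> \<open>The sentence of the smaller index fails for every larger number of generators,
    not only for the next one.\<close>
  then have "true_in (FL m) (generators_fm (min m n)) \<noteq> true_in (FL n) (generators_fm (min m n))"
    using generators_fm_true generators_fm_false by (cases "m < n") (auto simp: min_def)
  then show "\<exists>\<phi>. sentence \<phi> \<and> positive \<phi> \<and> true_in (FL m) \<phi> \<noteq> true_in (FL n) \<phi>"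
    using \<open>1 \<le> m\<close> \<open>1 \<le> n\<close> sentence_generators_fm positive_generators_fm
    by (intro exI[of _ "generators_fm (min m n)"]) simp
qed

end
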